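(* Let $\mathcal{A}\in\mathbb{C}^{I_{1}\times\cdots\times I_{M}\times J_{1}\times\cdots\times J_{N}}$ and $\mathcal{B}\in\mathbb{C}^{J_{1}\times\cdots\times J_{N}\times K_{1}\times\cdots\times K_{L}}$. Then $(\mathcal{A}*_N\mathcal{B})^{\dagger}=\mathcal{B}^{\dagger}*_N\mathcal{A}^{\dagger}$ holds if and only if both of the following conditions hold: (i) $(\mathcal{A}^{\dagger}*_M\mathcal{A}*_N\mathcal{B})^{\dagger}=\mathcal{B}^{\dagger}*_N\mathcal{A}^{\dagger}*_M\mathcal{A}$; (ii) $(\mathcal{A}*_N\mathcal{B})^{\dagger}=(\mathcal{A}^{\dagger}*_M\mathcal{A}*_N\mathcal{B})^{\dagger}*_N\mathcal{A}^{\dagger}$.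
   Context: Einstein product: for $\mathcal{A}\in\mathbb{C}^{I_1\times\cdots\times I_M\times J_1\times\cdots\times J_N}$ and $\mathcal{B}\in\mathbb{C}^{J_1\times\cdots\times J_N\times K_1\times\cdots\times K_L}$, $(\mathcal{A}*_N\mathcal{B})_{i_1\cdots i_Mk_1\cdots k_L}=\sum_{j_1,\dots,j_N}a_{i_1\cdots i_Mj_1\cdots j_N}b_{j_1\cdots j_Nk_1\cdots k_L}$; the subscript indicates the number of contracted modes ($*_M$, $*_L$ are analogous). Conjugate transpose: $(\mathcal{A}^H)_{j_1\cdots j_Ni_1\cdots i_M}=\overline{a_{i_1\cdots i_Mj_1\cdots j_N}}$. Moore--Penrose inverse: for $\mathcal{X}\in\mathbb{C}^{I_1\times\cdots\times I_M\times J_1\times\cdots\times J_N}$, $\mathcal{X}^\dagger$ is the unique $\mathcal{Y}\in\mathbb{C}^{J_1\times\cdots\times J_N\times I_1\times\cdots\times I_M}$ with (1) $\mathcal{X}*_N\mathcal{Y}*_M\mathcal{X}=\mathcal{X}$, (2) $\mathcal{Y}*_M\mathcal{X}*_N\mathcal{Y}=\mathcal{Y}$, (3) $(\mathcal{X}*_N\mathcal{Y})^H=\mathcal{X}*_N\mathcal{Y}$, (4) $(\mathcal{Y}*_M\mathcal{X})^H=\mathcal{Y}*_M\mathcal{X}$. *)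

theory Defs
  imports Complex_Main "HOL-Library.FuncSet"
begin

text \<open>
  A multi-index \<open>(i\<^sub>1, \<dots>, i\<^sub>r)\<close> is a list, with the 1-based range \<open>1 \<le> i\<^sub>k \<le> d\<^sub>k\<close>.
\<close>

definition multi_indices :: "nat list \<Rightarrow> nat list set" where
  "multi_indices ds = {is. list_all2 (\<lambda>i d. i \<in> {1..d}) is ds}"

text \<open>
  A complex tensor carries its list of dimensions. Entries outside the index range are fixed to
  \<open>undefined\<close>, so that equality of tensors is equality of dimensions and of in-range entries.
\<close>

typedef tensor =
  "{(ds, f :: nat list \<Rightarrow> complex). f \<in> extensional (multi_indices ds)}"
  by auto

setup_lifting type_definition_tensor

lift_definition dims :: "tensor \<Rightarrow> nat list" is fst .

lift_definition entry :: "tensor \<Rightarrow> nat list \<Rightarrow> complex" is snd .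

lift_definition mk_tensor :: "nat list \<Rightarrow> (nat list \<Rightarrow> complex) \<Rightarrow> tensor"
  is "\<lambda>ds f. (ds, restrict f (multi_indices ds))"
  by simp

lemma dims_mk_tensor [simp]: "dims (mk_tensor ds f) = ds"
  by transfer simp

lemma entry_mk_tensor [simp]: "is \<in> multi_indices ds \<Longrightarrow> entry (mk_tensor ds f) is = f is"
  by transfer simp

lemma tensor_eqI:
  assumes "dims X = dims Y"
    and "\<And>is. is \<in> multi_indices (dims Y) \<Longrightarrow> entry X is = entry Y is"
  shows "X = Y"
  using assms by transfer (auto intro: extensionalityI)

definition tensors :: "nat list \<Rightarrow> tensor set" where
  "tensors ds = {X. dims X = ds}"

definition order :: "tensor \<Rightarrow> nat" where
  "order X = length (dims X)"

text \<open>
  \<open>X \<star>\<^bsub>n\<^esub> Y\<close> contracts the last \<open>n\<close> modes of \<open>X\<close> with the first \<open>n\<close> modes of \<open>Y\<close>. It is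
  meaningful only if these dimensions agree; the range of summation is read off from \<open>X\<close>.
\<close>

definition einstein_prod :: "tensor \<Rightarrow> nat \<Rightarrow> tensor \<Rightarrow> tensor"
    ("(_ \<star>\<^bsub>_\<^esub> _)" [70, 0, 71] 70) where
  "X \<star>\<^bsub>n\<^esub> Y =
    (let m = order X - n in
      mk_tensor (take m (dims X) @ drop n (dims Y))
        (\<lambda>iks. \<Sum>js\<in>multi_indices (drop m (dims X)).
          entry X (take m iks @ js) * entry Y (js @ drop m iks)))"

text \<open>
  The conjugate transpose and the Moore--Penrose inverse depend on how the modes of the tensor are
  split into a row block and a column block: the first argument \<open>m\<close> is the number of row modes.
\<close>

definition conj_transpose :: "nat \<Rightarrow> tensor \<Rightarrow> tensor" where
  "conj_transpose m X =
    (let Is = take m (dims X); Js = drop m (dims X) in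
      mk_tensor (Js @ Is)
        (\<lambda>jis. cnj (entry X (drop (length Js) jis @ take (length Js) jis))))"

definition is_mp_inverse :: "nat \<Rightarrow> tensor \<Rightarrow> tensor \<Rightarrow> bool" where
  "is_mp_inverse m X Y \<longleftrightarrow>
    (let n = order X - m in
      Y \<in> tensors (drop m (dims X) @ take m (dims X)) \<and>
      X \<star>\<^bsub>n\<^esub> Y \<star>\<^bsub>m\<^esub> X = X \<and>
      Y \<star>\<^bsub>m\<^esub> X \<star>\<^bsub>n\<^esub> Y = Y \<and>
      conj_transpose m (X \<star>\<^bsub>n\<^esub> Y) = X \<star>\<^bsub>n\<^esub> Y \<and>
      conj_transpose n (Y \<star>\<^bsub>m\<^esub> X) = Y \<star>\<^bsub>m\<^esub> X)"

definition mp_inverse :: "nat \<Rightarrow> tensor \<Rightarrow> tensor" where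
  "mp_inverse m X = (THE Y. is_mp_inverse m X Y)"

end

theory Submission
  imports Defs
begin

text \<open>
  For every \<open>X\<close> the normal equations \<open>X\<^sup>H X Y = X\<^sup>H\<close> are solvable, by orthogonal projection onto the
  span of the columns of \<open>X\<close>. Any solution satisfies \<open>X Y X = X\<close> with \<open>X Y\<close> Hermitian; with a
  solution \<open>Z\<close> of the normal equations of \<open>X\<^sup>H\<close>, the tensor \<open>Z\<^sup>H X Y\<close> is the Moore--Penrose inverse.

  Let \<open>P = A\<^sup>\<dagger> A\<close>. If \<open>B\<^sup>\<dagger> A\<^sup>\<dagger>\<close> is the inverse of \<open>A B\<close>, then the four Penrose equations for the pair
  \<open>P B\<close>, \<open>B\<^sup>\<dagger> P\<close> follow by multiplying those for \<open>A B\<close>, \<open>B\<^sup>\<dagger> A\<^sup>\<dagger>\<close> by \<open>A\<^sup>\<dagger>\<close> or \<open>A\<close>, which gives (i), and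
  (ii) follows from \<open>P A\<^sup>\<dagger> = A\<^sup>\<dagger>\<close>. The converse is a substitution of (i) into (ii).
\<close>

section \<open>Multi-indices and comparison of tensors by blocks\<close>

lemma multi_indices_append:
  "is \<in> multi_indices (ds @ es) \<longleftrightarrow>
    (\<exists>us vs. is = us @ vs \<and> us \<in> multi_indices ds \<and> vs \<in> multi_indices es)"
  unfolding multi_indices_def list_all2_append2 by (auto dest: list_all2_lengthD)

lemma length_multi_indices: "is \<in> multi_indices ds \<Longrightarrow> length is = length ds"
  by (simp add: multi_indices_def list_all2_lengthD)

lemma finite_multi_indices [simp]: "finite (multi_indices ds)"
proof (induction ds)
  case Nil
  then show ?case by (simp add: multi_indices_def)
next
  case (Cons d ds)
  have "multi_indices (d # ds) = (\<lambda>(i, is). i # is) ` ({1..d} \<times> multi_indices ds)"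
    by (auto simp: multi_indices_def list_all2_Cons2 image_iff)
  with Cons show ?case by simp
qed

text \<open>Entries of products and conjugate transposes are computed at indices already split as
  \<open>is @ js\<close>; this rule confines comparisons to such indices.\<close>

lemma tensor_block_eqI:
  assumes "dims X = Is @ Js" and "dims Y = Is @ Js"
    and "\<And>is js. is \<in> multi_indices Is \<Longrightarrow> js \<in> multi_indices Js \<Longrightarrow>
      entry X (is @ js) = entry Y (is @ js)"
  shows "X = Y"
  using assms by (intro tensor_eqI) (auto simp: multi_indices_append)

section \<open>Entries of products and conjugate transposes in block form\<close>

lemma dims_einstein_prod [simp]:
  "dims (X \<star>\<^bsub>n\<^esub> Y) = take (order X - n) (dims X) @ drop n (dims Y)"
  by (simp add: einstein_prod_def Let_def)

lemma entry_einstein_prod: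
  assumes "dims X = Is @ Js" and "dims Y = Js @ Ks"
    and "is \<in> multi_indices Is" and "ks \<in> multi_indices Ks"
  shows "entry (X \<star>\<^bsub>length Js\<^esub> Y) (is @ ks) =
    (\<Sum>js\<in>multi_indices Js. entry X (is @ js) * entry Y (js @ ks))"
proof -
  have "is @ ks \<in> multi_indices (Is @ Ks)"
    using assms(3,4) by (auto simp: multi_indices_append)
  then show ?thesis
    using assms length_multi_indices[OF assms(3)]
    by (simp add: einstein_prod_def Let_def order_def)
qed

lemma dims_conj_transpose [simp]:
  "dims (conj_transpose m X) = drop m (dims X) @ take m (dims X)"
  by (simp add: conj_transpose_def Let_def)

lemma entry_conj_transpose:
  assumes "dims X = Is @ Js" and "is \<in> multi_indices Is" and "js \<in> multi_indices Js"
  shows "entry (conj_transpose (length Is) X) (js @ is) = cnj (entry X (is @ js))"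
proof -
  have "js @ is \<in> multi_indices (Js @ Is)"
    using assms(2,3) by (auto simp: multi_indices_append)
  then show ?thesis
    using assms(1) length_multi_indices[OF assms(3)]
    by (simp add: conj_transpose_def Let_def)
qed

section \<open>Associativity and conjugate transposition of products\<close>

text \<open>Both sides expand to the same finite double sum over \<open>js\<close> and
  \<open>ks\<close>, with the order of summation exchanged.\<close>

lemma einstein_prod_assoc_block:
  assumes X: "dims X = Is @ Js" and Y: "dims Y = Js @ Ks" and Z: "dims Z = Ks @ Ls"
  shows "X \<star>\<^bsub>length Js\<^esub> Y \<star>\<^bsub>length Ks\<^esub> Z = X \<star>\<^bsub>length Js\<^esub> (Y \<star>\<^bsub>length Ks\<^esub> Z)"
proof (rule tensor_block_eqI[where Is = Is and Js = Ls])
  fix "is" ls assume i: "is \<in> multi_indices Is" and l: "ls \<in> multi_indices Ls"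
  have XY: "dims (X \<star>\<^bsub>length Js\<^esub> Y) = Is @ Ks" and YZ: "dims (Y \<star>\<^bsub>length Ks\<^esub> Z) = Js @ Ls"
    using assms by (simp_all add: order_def)
  have "entry (X \<star>\<^bsub>length Js\<^esub> Y \<star>\<^bsub>length Ks\<^esub> Z) (is @ ls) =
      (\<Sum>ks\<in>multi_indices Ks. \<Sum>js\<in>multi_indices Js.
        entry X (is @ js) * entry Y (js @ ks) * entry Z (ks @ ls))"
    using entry_einstein_prod[OF XY Z i l] entry_einstein_prod[OF X Y i]
    by (simp add: sum_distrib_right)
  also have "\<dots> = (\<Sum>js\<in>multi_indices Js. \<Sum>ks\<in>multi_indices Ks.
        entry X (is @ js) * entry Y (js @ ks) * entry Z (ks @ ls))"
    by (rule sum.swap)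
  also have "\<dots> = entry (X \<star>\<^bsub>length Js\<^esub> (Y \<star>\<^bsub>length Ks\<^esub> Z)) (is @ ls)"
    using entry_einstein_prod[OF X YZ i l] entry_einstein_prod[OF Y Z _ l]
    by (simp add: sum_distrib_left mult.assoc)
  finally show "entry (X \<star>\<^bsub>length Js\<^esub> Y \<star>\<^bsub>length Ks\<^esub> Z) (is @ ls) =
      entry (X \<star>\<^bsub>length Js\<^esub> (Y \<star>\<^bsub>length Ks\<^esub> Z)) (is @ ls)" .
qed (use assms in \<open>simp_all add: order_def\<close>)

text \<open>
  The side conditions below are phrased through \<^const>\<open>dims\<close> rather than through a block decomposition,
  so that they contain no extra variables and the simplifier can discharge them.
\<close>

lemma einstein_prod_assoc:
  assumes "n \<le> order X" and "p \<le> order Z" and "order Y = n + p"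
    and "drop (order X - n) (dims X) = take n (dims Y)" and "take p (dims Z) = drop n (dims Y)"
  shows "X \<star>\<^bsub>n\<^esub> Y \<star>\<^bsub>p\<^esub> Z = X \<star>\<^bsub>n\<^esub> (Y \<star>\<^bsub>p\<^esub> Z)"
proof -
  have "dims X = take (order X - n) (dims X) @ take n (dims Y)"
    by (metis append_take_drop_id assms(4))
  moreover have "dims Z = drop n (dims Y) @ drop p (dims Z)"
    by (metis append_take_drop_id assms(5))
  ultimately have "X \<star>\<^bsub>length (take n (dims Y))\<^esub> Y \<star>\<^bsub>length (drop n (dims Y))\<^esub> Z =
      X \<star>\<^bsub>length (take n (dims Y))\<^esub> (Y \<star>\<^bsub>length (drop n (dims Y))\<^esub> Z)"
    by (intro einstein_prod_assoc_block) auto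
  with assms(3) show ?thesis by (simp add: order_def)
qed

text \<open>The outer operation splits after \<open>n\<close> modes because the inner one has moved
  the column block, of length \<open>n\<close>, to the front.\<close>

lemma conj_transpose_conj_transpose:
  assumes "order X = m + n"
  shows "conj_transpose n (conj_transpose m X) = X"
proof -
  define Is Js where "Is = take m (dims X)" and "Js = drop m (dims X)"
  have X: "dims X = Is @ Js" and [simp]: "length Is = m" "length Js = n"
    using assms by (simp_all add: Is_def Js_def order_def)
  have XH: "dims (conj_transpose m X) = Js @ Is" using X by simp
  show ?thesis
  proof (rule tensor_block_eqI[where Is = Is and Js = Js])
    fix "is" js assume i: "is \<in> multi_indices Is" and j: "js \<in> multi_indices Js"
    show "entry (conj_transpose n (conj_transpose m X)) (is @ js) = entry X (is @ js)"
      using entry_conj_transpose[OF XH j i] entry_conj_transpose[OF X i j] by simp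
  qed (use X in simp_all)
qed

lemma conj_transpose_einstein_prod:
  assumes "order X = m + n" and "n \<le> order Y" and "drop m (dims X) = take n (dims Y)"
  shows "conj_transpose m (X \<star>\<^bsub>n\<^esub> Y) = conj_transpose n Y \<star>\<^bsub>n\<^esub> conj_transpose m X"
proof -
  define Is Js Ks where "Is = take m (dims X)" and "Js = drop m (dims X)" and "Ks = drop n (dims Y)"
  have X: "dims X = Is @ Js"
    unfolding Is_def Js_def by simp
  have m: "length Is = m" and n: "length Js = n"
    using assms(1) by (simp_all add: Is_def Js_def order_def)
  have Y: "dims Y = Js @ Ks"
    using assms(3) by (simp add: Js_def Ks_def)
  have XH: "dims (conj_transpose m X) = Js @ Is" and YH: "dims (conj_transpose n Y) = Ks @ Js"
    and XY: "dims (X \<star>\<^bsub>n\<^esub> Y) = Is @ Ks"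
    using X Y m n by (simp_all add: order_def)
  show ?thesis
  proof (rule tensor_block_eqI[where Is = Ks and Js = Is])
    fix ks "is" assume k: "ks \<in> multi_indices Ks" and i: "is \<in> multi_indices Is"
    show "entry (conj_transpose m (X \<star>\<^bsub>n\<^esub> Y)) (ks @ is) =
        entry (conj_transpose n Y \<star>\<^bsub>n\<^esub> conj_transpose m X) (ks @ is)"
      using entry_conj_transpose[OF XY i k] entry_einstein_prod[OF X Y i k]
        entry_einstein_prod[OF YH XH k i] entry_conj_transpose[OF X i] entry_conj_transpose[OF Y _ k]
      by (simp add: m n mult.commute)
  qed (use X Y m n in \<open>simp_all add: order_def\<close>)
qed

section \<open>Orthogonal projection and the normal equations\<close>

text \<open>A Gram-Schmidt step by induction on \<open>J\<close>, with linearly dependent families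
  allowed. The new vector \<open>v l\<close> is replaced by its component \<open>u\<close>
  orthogonal to the old ones, and the residual \<open>r\<close> of \<open>b\<close> is corrected
  along \<open>u\<close>.\<close>

lemma orthogonal_projection_exists:
  fixes v :: "'j \<Rightarrow> 'i \<Rightarrow> complex"
  assumes "finite I" and "finite J"
  shows "\<exists>x. \<forall>k\<in>J. (\<Sum>i\<in>I. cnj (v k i) * (b i - (\<Sum>j\<in>J. x j * v j i))) = 0"
  using assms(2)
proof (induction J arbitrary: b rule: finite_induct)
  case empty
  then show ?case by simp
next
  case (insert l J)
  obtain x where x: "\<forall>k\<in>J. (\<Sum>i\<in>I. cnj (v k i) * (b i - (\<Sum>j\<in>J. x j * v j i))) = 0"
    using insert.IH by blast
  \<comment> \<open>The induction hypothesis is applied to \<open>v l\<close> in place of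
    \<open>b\<close>; this is why \<open>b\<close> is generalized.\<close>
  obtain y where y: "\<forall>k\<in>J. (\<Sum>i\<in>I. cnj (v k i) * (v l i - (\<Sum>j\<in>J. y j * v j i))) = 0"
    using insert.IH by blast
  define r where "r i = b i - (\<Sum>j\<in>J. x j * v j i)" for i
  define u where "u i = v l i - (\<Sum>j\<in>J. y j * v j i)" for i
  define S where "S = (\<Sum>i\<in>I. cnj (u i) * u i)"
  \<comment> \<open>If \<open>S = 0\<close> then \<open>u = 0\<close> on \<open>I\<close>, and the junk value \<open>c = 0\<close> is the right coefficient.\<close>
  define c where "c = (\<Sum>i\<in>I. cnj (u i) * r i) / S"
  \<comment> \<open>These are the coefficients of the \<open>x\<close>-combination plus
    \<open>c u\<close>, after expanding \<open>u\<close> as \<open>v l\<close> minus the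
    \<open>y\<close>-combination.\<close>
  define z where "z j = (if j = l then c else x j - c * y j)" for j
  have z: "b i - (\<Sum>j\<in>insert l J. z j * v j i) = r i - c * u i" for i
  proof -
    have "(\<Sum>j\<in>J. z j * v j i) = (\<Sum>j\<in>J. (x j - c * y j) * v j i)"
      using insert.hyps(2) by (intro sum.cong) (auto simp: z_def)
    also have "\<dots> = (\<Sum>j\<in>J. x j * v j i) - c * (\<Sum>j\<in>J. y j * v j i)"
      by (simp add: left_diff_distrib sum_subtractf sum_distrib_left mult.assoc)
    finally show ?thesis
      using insert.hyps by (simp add: z_def r_def u_def algebra_simps)
  qed
  have orth_J: "(\<Sum>i\<in>I. cnj (v k i) * (r i - c * u i)) = 0" if "k \<in> J" for k
  proof -
    have "(\<Sum>i\<in>I. cnj (v k i) * (r i - c * u i)) =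
        (\<Sum>i\<in>I. cnj (v k i) * r i) - c * (\<Sum>i\<in>I. cnj (v k i) * u i)"
      by (simp add: right_diff_distrib sum_subtractf sum_distrib_left algebra_simps)
    then show ?thesis using x y that by (simp add: r_def u_def)
  qed
  have orth_u: "(\<Sum>i\<in>I. cnj (u i) * (r i - c * u i)) = 0"
  proof (cases "S = 0")
    case True
    have "S = of_real (\<Sum>i\<in>I. (cmod (u i))\<^sup>2)"
      by (simp add: S_def complex_norm_square mult.commute del: of_real_power)
    with True have "(\<Sum>i\<in>I. (cmod (u i))\<^sup>2) = 0"
      by (metis of_real_eq_0_iff)
    then have "\<forall>i\<in>I. u i = 0"
      using assms(1) by (simp add: sum_nonneg_eq_0_iff)
    then show ?thesis by simp
  next
    case False
    have "(\<Sum>i\<in>I. cnj (u i) * (r i - c * u i)) = (\<Sum>i\<in>I. cnj (u i) * r i) - c * S"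
      by (simp add: S_def right_diff_distrib sum_subtractf sum_distrib_left algebra_simps)
    with False show ?thesis by (simp add: c_def)
  qed
  \<comment> \<open>Since \<open>v l\<close> is \<open>u\<close> plus the
    \<open>y\<close>-combination of the old vectors, orthogonality to \<open>v l\<close> reduces to
    orthogonality to \<open>u\<close> and to the old vectors.\<close>
  have "(\<Sum>i\<in>I. cnj (v l i) * (r i - c * u i)) =
      (\<Sum>i\<in>I. cnj (u i) * (r i - c * u i)) +
      (\<Sum>j\<in>J. cnj (y j) * (\<Sum>i\<in>I. cnj (v j i) * (r i - c * u i)))"
  proof -
    have "(\<Sum>j\<in>J. cnj (y j) * (\<Sum>i\<in>I. cnj (v j i) * (r i - c * u i))) =
        (\<Sum>i\<in>I. \<Sum>j\<in>J. cnj (y j) * (cnj (v j i) * (r i - c * u i)))"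
      unfolding sum_distrib_left by (rule sum.swap)
    moreover have "cnj (v l i) = cnj (u i) + (\<Sum>j\<in>J. cnj (y j) * cnj (v j i))" for i
      by (simp add: u_def)
    ultimately show ?thesis
      by (simp add: distrib_right sum.distrib sum_distrib_right mult.assoc)
  qed
  then have "(\<Sum>i\<in>I. cnj (v l i) * (r i - c * u i)) = 0"
    using orth_u orth_J by simp
  then have "\<forall>k\<in>insert l J.
      (\<Sum>i\<in>I. cnj (v k i) * (b i - (\<Sum>j\<in>insert l J. z j * v j i))) = 0"
    unfolding z using orth_J by blast
  then show ?case by blast
qed

text \<open>Column \<open>c\<close> of \<open>Y\<close> consists of the coefficients that project
  the unit vector at \<open>c\<close> onto the span of the columns of \<open>X\<close>.
  Orthogonality of all residuals to these columns says that
  \<open>X^H (X Y - I) = 0\<close>.\<close>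

lemma normal_equations_solvable:
  assumes X: "dims X = Is @ Js"
  shows "\<exists>Y. dims Y = Js @ Is \<and>
    conj_transpose (length Is) X \<star>\<^bsub>length Is\<^esub> (X \<star>\<^bsub>length Js\<^esub> Y) = conj_transpose (length Is) X"
proof -
  \<comment> \<open>The indicator of \<open>i = c\<close> is the unit vector at \<open>c\<close>.
    For a list \<open>c\<close> out of range it vanishes on the index set, and the solution chosen
    for it does not enter \<open>Y\<close>.\<close>
  have "\<forall>c. \<exists>x. \<forall>k\<in>multi_indices Js. (\<Sum>i\<in>multi_indices Is. cnj (entry X (i @ k)) *
      ((if i = c then 1 else 0) - (\<Sum>j\<in>multi_indices Js. x j * entry X (i @ j)))) = 0"
    by (intro allI orthogonal_projection_exists) simp_all
  from choice[OF this] obtain x where x: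
    "\<forall>c. \<forall>k\<in>multi_indices Js. (\<Sum>i\<in>multi_indices Is. cnj (entry X (i @ k)) *
      ((if i = c then 1 else 0) - (\<Sum>j\<in>multi_indices Js. x c j * entry X (i @ j)))) = 0"
    by (rule exE)
  \<comment> \<open>The function \<open>x\<close> takes the column index of \<open>Y\<close> first,
    whereas the modes of \<open>Y\<close> list the row index first; hence \<open>drop\<close>
    precedes \<open>take\<close>.\<close>
  define Y where "Y = mk_tensor (Js @ Is) (\<lambda>ji. x (drop (length Js) ji) (take (length Js) ji))"
  have Y: "dims Y = Js @ Is" by (simp add: Y_def)
  have entry_Y: "entry Y (js @ is) = x is js"
    if "js \<in> multi_indices Js" "is \<in> multi_indices Is" for js "is"
  proof -
    have "js @ is \<in> multi_indices (Js @ Is)"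
      using that by (auto simp: multi_indices_append)
    then show ?thesis using length_multi_indices[OF that(1)] by (simp add: Y_def)
  qed
  have XY: "dims (X \<star>\<^bsub>length Js\<^esub> Y) = Is @ Is"
    and XH: "dims (conj_transpose (length Is) X) = Js @ Is"
    using X Y by (simp_all add: order_def)
  have "conj_transpose (length Is) X \<star>\<^bsub>length Is\<^esub> (X \<star>\<^bsub>length Js\<^esub> Y) = conj_transpose (length Is) X"
  proof (rule tensor_block_eqI[where Is = Js and Js = Is])
    fix k c assume k: "k \<in> multi_indices Js" and c: "c \<in> multi_indices Is"
    have "entry (conj_transpose (length Is) X \<star>\<^bsub>length Is\<^esub> (X \<star>\<^bsub>length Js\<^esub> Y)) (k @ c) =
        (\<Sum>i\<in>multi_indices Is. cnj (entry X (i @ k)) *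
          (\<Sum>j\<in>multi_indices Js. x c j * entry X (i @ j)))"
      using entry_einstein_prod[OF XH XY k c] entry_einstein_prod[OF X Y _ c]
        entry_conj_transpose[OF X _ k] entry_Y[OF _ c]
      by (simp add: mult.commute)
    also have "\<dots> = (\<Sum>i\<in>multi_indices Is. cnj (entry X (i @ k)) * (if i = c then 1 else 0))"
      using x[rule_format, OF k, of c] by (simp add: right_diff_distrib sum_subtractf)
    also have "\<dots> = cnj (entry X (c @ k))"
      using c by (simp add: if_distrib cong: if_cong)
    also have "\<dots> = entry (conj_transpose (length Is) X) (k @ c)"
      using entry_conj_transpose[OF X c k] by simp
    finally show "entry (conj_transpose (length Is) X \<star>\<^bsub>length Is\<^esub> (X \<star>\<^bsub>length Js\<^esub> Y)) (k @ c) =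
        entry (conj_transpose (length Is) X) (k @ c)" .
  qed (use X Y in \<open>simp_all add: order_def\<close>)
  with Y show ?thesis by blast
qed

text \<open>Penrose equations (1) and (3) from the normal equations: with \<open>W = X Y\<close>,
  conjugate transposition gives \<open>W^H X = X\<close>. Multiplying by \<open>Y\<close> gives
  \<open>W^H W = W\<close>, so \<open>W\<close> is Hermitian and \<open>W X = X\<close>.\<close>

lemma one_three_inverse_exists:
  assumes X: "dims X = Is @ Js"
  shows "\<exists>Y. dims Y = Js @ Is \<and> X \<star>\<^bsub>length Js\<^esub> Y \<star>\<^bsub>length Is\<^esub> X = X \<and>
    conj_transpose (length Is) (X \<star>\<^bsub>length Js\<^esub> Y) = X \<star>\<^bsub>length Js\<^esub> Y"
proof -
  define XH where "XH = conj_transpose (length Is) X"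
  obtain Y where Y: "dims Y = Js @ Is"
    and eq: "XH \<star>\<^bsub>length Is\<^esub> (X \<star>\<^bsub>length Js\<^esub> Y) = XH"
    using normal_equations_solvable[OF X] unfolding XH_def by blast
  define W where "W = X \<star>\<^bsub>length Js\<^esub> Y"
  define WH where "WH = conj_transpose (length Is) W"
  have [simp]: "dims XH = Js @ Is" "dims W = Is @ Is" "dims WH = Is @ Is"
    using X Y by (simp_all add: XH_def W_def WH_def order_def)
  have [simp]: "conj_transpose (length Js) XH = X"
    unfolding XH_def using X by (intro conj_transpose_conj_transpose) (simp add: order_def)
  have "conj_transpose (length Js) (XH \<star>\<^bsub>length Is\<^esub> W) = WH \<star>\<^bsub>length Is\<^esub> X"
    using X by (subst conj_transpose_einstein_prod) (simp_all add: order_def WH_def)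
  with eq have WHX: "WH \<star>\<^bsub>length Is\<^esub> X = X" by (simp add: W_def)
  then have WHW: "WH \<star>\<^bsub>length Is\<^esub> W = W"
    unfolding W_def using X Y
    by (subst einstein_prod_assoc[symmetric]) (simp_all add: order_def)
  \<comment> \<open>\<open>W = W\<^sup>H W\<close> and the right-hand side is Hermitian.\<close>
  have "conj_transpose (length Is) (WH \<star>\<^bsub>length Is\<^esub> W) = WH \<star>\<^bsub>length Is\<^esub> W"
    by (subst conj_transpose_einstein_prod)
      (simp_all add: order_def WH_def conj_transpose_conj_transpose)
  with WHW have "WH = W" by (simp add: WH_def)
  with WHX show ?thesis using Y unfolding WH_def W_def by auto
qed

section \<open>Existence and uniqueness of the Moore-Penrose inverse\<close>

lemma is_mp_inverse_block:
  assumes "dims X = Is @ Js"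
  shows "is_mp_inverse (length Is) X Y \<longleftrightarrow>
    dims Y = Js @ Is \<and>
    X \<star>\<^bsub>length Js\<^esub> Y \<star>\<^bsub>length Is\<^esub> X = X \<and>
    Y \<star>\<^bsub>length Is\<^esub> X \<star>\<^bsub>length Js\<^esub> Y = Y \<and>
    conj_transpose (length Is) (X \<star>\<^bsub>length Js\<^esub> Y) = X \<star>\<^bsub>length Js\<^esub> Y \<and>
    conj_transpose (length Js) (Y \<star>\<^bsub>length Is\<^esub> X) = Y \<star>\<^bsub>length Is\<^esub> X"
  using assms by (simp add: is_mp_inverse_def tensors_def order_def Let_def)

text \<open>This is \<open>X Y X = X\<close> in the form needed after products are nested to the
  right, where \<open>X Y X\<close> is no longer a subterm.\<close>

lemma inner_inverse_cancel:
  assumes "dims X = Is @ Js" and "dims Y = Js @ Is" and "dims T = Js @ Ts"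
    and "X \<star>\<^bsub>length Js\<^esub> Y \<star>\<^bsub>length Is\<^esub> X = X"
  shows "X \<star>\<^bsub>length Js\<^esub> (Y \<star>\<^bsub>length Is\<^esub> (X \<star>\<^bsub>length Js\<^esub> T)) = X \<star>\<^bsub>length Js\<^esub> T"
proof -
  have "X \<star>\<^bsub>length Js\<^esub> (Y \<star>\<^bsub>length Is\<^esub> (X \<star>\<^bsub>length Js\<^esub> T)) =
      X \<star>\<^bsub>length Js\<^esub> Y \<star>\<^bsub>length Is\<^esub> X \<star>\<^bsub>length Js\<^esub> T"
    using assms(1-3) by (simp add: einstein_prod_assoc order_def)
  with assms(4) show ?thesis by simp
qed

text \<open>If \<open>Y\<close> satisfies (1) and (3) and \<open>Z\<close> satisfies (1) and (4),
  then \<open>Z X Y\<close> satisfies all four equations, because \<open>X (Z X Y) = X Y\<close> and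
  \<open>(Z X Y) X = Z X\<close>.\<close>

lemma is_mp_inverse_exists:
  assumes X: "dims X = Is @ Js"
  shows "\<exists>Y. is_mp_inverse (length Is) X Y"
proof -
  define XH where "XH = conj_transpose (length Is) X"
  have XH: "dims XH = Js @ Is" using X by (simp add: XH_def)
  have XHH: "conj_transpose (length Js) XH = X"
    unfolding XH_def using X by (intro conj_transpose_conj_transpose) (simp add: order_def)
  obtain Y where Y: "dims Y = Js @ Is" and XYX: "X \<star>\<^bsub>length Js\<^esub> Y \<star>\<^bsub>length Is\<^esub> X = X"
    and XY: "conj_transpose (length Is) (X \<star>\<^bsub>length Js\<^esub> Y) = X \<star>\<^bsub>length Js\<^esub> Y"
    using one_three_inverse_exists[OF X] by blast
  obtain V where V: "dims V = Is @ Js" and VXV: "XH \<star>\<^bsub>length Is\<^esub> V \<star>\<^bsub>length Js\<^esub> XH = XH"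
    and XHV: "conj_transpose (length Js) (XH \<star>\<^bsub>length Is\<^esub> V) = XH \<star>\<^bsub>length Is\<^esub> V"
    using one_three_inverse_exists[OF XH] by blast
  define Z where "Z = conj_transpose (length Is) V"
  have Z: "dims Z = Js @ Is" using V by (simp add: Z_def)
  have "conj_transpose (length Js) (XH \<star>\<^bsub>length Is\<^esub> V \<star>\<^bsub>length Js\<^esub> XH) =
      X \<star>\<^bsub>length Js\<^esub> (Z \<star>\<^bsub>length Is\<^esub> X)"
    using V XH X by (simp add: conj_transpose_einstein_prod order_def XHH flip: Z_def)
  then have XZX: "X \<star>\<^bsub>length Js\<^esub> (Z \<star>\<^bsub>length Is\<^esub> X) = X"
    by (simp add: VXV XHH)
  have ZX: "conj_transpose (length Js) (XH \<star>\<^bsub>length Is\<^esub> V) = Z \<star>\<^bsub>length Is\<^esub> X"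
    using V XH by (simp add: conj_transpose_einstein_prod order_def XHH flip: Z_def)
  then have ZX_herm: "conj_transpose (length Js) (Z \<star>\<^bsub>length Is\<^esub> X) = Z \<star>\<^bsub>length Is\<^esub> X"
    using XHV by simp
  have XZX': "X \<star>\<^bsub>length Js\<^esub> Z \<star>\<^bsub>length Is\<^esub> X = X"
    using XZX X Z by (simp add: einstein_prod_assoc order_def)
  have XYX': "X \<star>\<^bsub>length Js\<^esub> (Y \<star>\<^bsub>length Is\<^esub> X) = X"
    using XYX X Y by (simp add: einstein_prod_assoc order_def)
  note cancel = inner_inverse_cancel[OF X Z Y XZX']
  have "is_mp_inverse (length Is) X (Z \<star>\<^bsub>length Is\<^esub> (X \<star>\<^bsub>length Js\<^esub> Y))"
    unfolding is_mp_inverse_block[OF X]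
    using X Y Z XY ZX_herm
    by (simp add: einstein_prod_assoc order_def cancel XYX' XZX)
  then show ?thesis by blast
qed

text \<open>Penrose's argument: \<open>X Y = (X Z) (X Y)\<close> is Hermitian, so it equals the
  reversed product \<open>(X Y) (X Z) = X Z\<close>. Likewise \<open>Y X = Z X\<close>, and then
  \<open>Y = Y X Y = Z X Y = Z X Z = Z\<close>.\<close>

lemma is_mp_inverse_unique:
  assumes X: "dims X = Is @ Js"
    and mpY: "is_mp_inverse (length Is) X Y" and mpZ: "is_mp_inverse (length Is) X Z"
  shows "Y = Z"
proof -
  note Y = mpY[unfolded is_mp_inverse_block[OF X]] and Z = mpZ[unfolded is_mp_inverse_block[OF X]]
  have dims: "dims X = Is @ Js" "dims Y = Js @ Is" "dims Z = Js @ Is"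
    using X Y Z by auto
  note assoc = einstein_prod_assoc order_def dims
  have "X \<star>\<^bsub>length Js\<^esub> Y = (X \<star>\<^bsub>length Js\<^esub> Z) \<star>\<^bsub>length Is\<^esub> (X \<star>\<^bsub>length Js\<^esub> Y)"
    using inner_inverse_cancel[of X Is Js Z Y] Z dims by (simp add: assoc)
  then have "X \<star>\<^bsub>length Js\<^esub> Y =
      conj_transpose (length Is) ((X \<star>\<^bsub>length Js\<^esub> Z) \<star>\<^bsub>length Is\<^esub> (X \<star>\<^bsub>length Js\<^esub> Y))"
    using Y by simp
  also have "\<dots> = (X \<star>\<^bsub>length Js\<^esub> Y) \<star>\<^bsub>length Is\<^esub> (X \<star>\<^bsub>length Js\<^esub> Z)"
    using Y Z by (subst conj_transpose_einstein_prod) (simp_all add: order_def dims)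
  also have "\<dots> = X \<star>\<^bsub>length Js\<^esub> Z"
    using inner_inverse_cancel[of X Is Js Y Z] Y dims by (simp add: assoc)
  finally have XY: "X \<star>\<^bsub>length Js\<^esub> Y = X \<star>\<^bsub>length Js\<^esub> Z" .
  have "Y \<star>\<^bsub>length Is\<^esub> X = (Y \<star>\<^bsub>length Is\<^esub> X) \<star>\<^bsub>length Js\<^esub> (Z \<star>\<^bsub>length Is\<^esub> X)"
    using Z by (simp add: assoc)
  then have "Y \<star>\<^bsub>length Is\<^esub> X =
      conj_transpose (length Js) ((Y \<star>\<^bsub>length Is\<^esub> X) \<star>\<^bsub>length Js\<^esub> (Z \<star>\<^bsub>length Is\<^esub> X))"
    using Y by simp
  also have "\<dots> = (Z \<star>\<^bsub>length Is\<^esub> X) \<star>\<^bsub>length Js\<^esub> (Y \<star>\<^bsub>length Is\<^esub> X)"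
    using Y Z by (subst conj_transpose_einstein_prod) (simp_all add: order_def dims)
  also have "\<dots> = Z \<star>\<^bsub>length Is\<^esub> X"
    using Y by (simp add: assoc)
  finally have YX: "Y \<star>\<^bsub>length Is\<^esub> X = Z \<star>\<^bsub>length Is\<^esub> X" .
  have "Y = Y \<star>\<^bsub>length Is\<^esub> X \<star>\<^bsub>length Js\<^esub> Y"
    using Y by simp
  also have "\<dots> = Z \<star>\<^bsub>length Is\<^esub> (X \<star>\<^bsub>length Js\<^esub> Y)"
    unfolding YX by (simp add: assoc)
  also have "\<dots> = Z \<star>\<^bsub>length Is\<^esub> X \<star>\<^bsub>length Js\<^esub> Z"
    unfolding XY by (simp add: assoc)
  also have "\<dots> = Z"
    using Z by simp
  finally show ?thesis .
qed

lemma mp_inverse_eqI: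
  assumes "dims X = Is @ Js" and "is_mp_inverse (length Is) X Y"
  shows "mp_inverse (length Is) X = Y"
  unfolding mp_inverse_def using assms is_mp_inverse_unique by blast

lemma is_mp_inverse_mp_inverse:
  assumes "dims X = Is @ Js"
  shows "is_mp_inverse (length Is) X (mp_inverse (length Is) X)"
  using is_mp_inverse_exists[OF assms] mp_inverse_eqI[OF assms] by auto

section \<open>The reverse order law\<close>

lemma mp_inverse_restrict_row_space:
  assumes A: "dims A = Is @ Js" and B: "dims B = Js @ Ks"
    and mpA: "is_mp_inverse (length Is) A A'" and mpB: "is_mp_inverse (length Js) B B'"
    and mpAB: "is_mp_inverse (length Is) (A \<star>\<^bsub>length Js\<^esub> B) (B' \<star>\<^bsub>length Js\<^esub> A')"
  shows "is_mp_inverse (length Js) (A' \<star>\<^bsub>length Is\<^esub> A \<star>\<^bsub>length Js\<^esub> B)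
    (B' \<star>\<^bsub>length Js\<^esub> A' \<star>\<^bsub>length Is\<^esub> A)"
proof -
  have AB: "dims (A \<star>\<^bsub>length Js\<^esub> B) = Is @ Ks"
    using A B by (simp add: order_def)
  note pA = mpA[unfolded is_mp_inverse_block[OF A]] and pB = mpB[unfolded is_mp_inverse_block[OF B]]
    and pAB = mpAB[unfolded is_mp_inverse_block[OF AB]]
  have dims: "dims A = Is @ Js" "dims A' = Js @ Is" "dims B = Js @ Ks" "dims B' = Ks @ Js"
    using A B pA pB by auto
  note assoc = einstein_prod_assoc order_def dims
  \<comment> \<open>Hermitian and idempotent, \<open>P\<close> is the orthogonal projection onto the
    range of \<open>A^H\<close>.\<close>
  define P where "P = A' \<star>\<^bsub>length Is\<^esub> A"
  have P: "dims P = Js @ Js" by (simp add: P_def order_def dims)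
  have P_herm: "conj_transpose (length Js) P = P" using pA by (simp add: P_def)
  have PP: "P \<star>\<^bsub>length Js\<^esub> P = P" using pA by (simp add: P_def assoc)
  have PB: "dims (P \<star>\<^bsub>length Js\<^esub> B) = Js @ Ks" by (simp add: order_def P dims)
  have cancel_A: "A \<star>\<^bsub>length Js\<^esub> (A' \<star>\<^bsub>length Is\<^esub> (A \<star>\<^bsub>length Js\<^esub> B)) = A \<star>\<^bsub>length Js\<^esub> B"
    using pA by (intro inner_inverse_cancel[of _ _ _ _ _ Ks]) (simp_all add: dims)
  have h1: "A \<star>\<^bsub>length Js\<^esub> (B \<star>\<^bsub>length Ks\<^esub> (B' \<star>\<^bsub>length Js\<^esub> (A' \<star>\<^bsub>length Is\<^esub> (A \<star>\<^bsub>length Js\<^esub> B)))) =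
      A \<star>\<^bsub>length Js\<^esub> B"
    using pAB by (simp add: assoc)
  have "B' \<star>\<^bsub>length Js\<^esub> A' \<star>\<^bsub>length Is\<^esub> (A \<star>\<^bsub>length Js\<^esub> B) \<star>\<^bsub>length Ks\<^esub> (B' \<star>\<^bsub>length Js\<^esub> A') \<star>\<^bsub>length Is\<^esub> A =
      B' \<star>\<^bsub>length Js\<^esub> A' \<star>\<^bsub>length Is\<^esub> A"
    using pAB by simp
  then have h2: "B' \<star>\<^bsub>length Js\<^esub> (A' \<star>\<^bsub>length Is\<^esub> (A \<star>\<^bsub>length Js\<^esub>
      (B \<star>\<^bsub>length Ks\<^esub> (B' \<star>\<^bsub>length Js\<^esub> (A' \<star>\<^bsub>length Is\<^esub> A))))) = B' \<star>\<^bsub>length Js\<^esub> (A' \<star>\<^bsub>length Is\<^esub> A)"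
    by (simp add: assoc)
  have "conj_transpose (length Js) (P \<star>\<^bsub>length Js\<^esub> (B \<star>\<^bsub>length Ks\<^esub> B' \<star>\<^bsub>length Js\<^esub> P)) =
      P \<star>\<^bsub>length Js\<^esub> (B \<star>\<^bsub>length Ks\<^esub> B') \<star>\<^bsub>length Js\<^esub> P"
    using P_herm pB
    by (subst conj_transpose_einstein_prod, simp_all add: order_def P dims)+
  then have h3: "conj_transpose (length Js) (P \<star>\<^bsub>length Js\<^esub> B \<star>\<^bsub>length Ks\<^esub> (B' \<star>\<^bsub>length Js\<^esub> P)) =
      P \<star>\<^bsub>length Js\<^esub> B \<star>\<^bsub>length Ks\<^esub> (B' \<star>\<^bsub>length Js\<^esub> P)"
    by (simp add: assoc P)
  \<comment> \<open>Contracting \<open>P P\<close> turns this product into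
    \<open>(B' A') (A B)\<close>, which is Hermitian by equation (4) for \<open>A B\<close>.\<close>
  have "B' \<star>\<^bsub>length Js\<^esub> P \<star>\<^bsub>length Js\<^esub> (P \<star>\<^bsub>length Js\<^esub> B) =
      B' \<star>\<^bsub>length Js\<^esub> A' \<star>\<^bsub>length Is\<^esub> (A \<star>\<^bsub>length Js\<^esub> B)"
    by (simp add: assoc P_def cancel_A)
  then have h4: "conj_transpose (length Ks) (B' \<star>\<^bsub>length Js\<^esub> P \<star>\<^bsub>length Js\<^esub> (P \<star>\<^bsub>length Js\<^esub> B)) =
      B' \<star>\<^bsub>length Js\<^esub> P \<star>\<^bsub>length Js\<^esub> (P \<star>\<^bsub>length Js\<^esub> B)"
    using pAB by simp
  have "is_mp_inverse (length Js) (P \<star>\<^bsub>length Js\<^esub> B) (B' \<star>\<^bsub>length Js\<^esub> P)"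
    unfolding is_mp_inverse_block[OF PB]
  proof (intro conjI)
    \<comment> \<open>After \<open>P P\<close> is contracted, this is \<open>h1\<close> multiplied
      on the left by \<open>A'\<close>.\<close>
    show "P \<star>\<^bsub>length Js\<^esub> B \<star>\<^bsub>length Ks\<^esub> (B' \<star>\<^bsub>length Js\<^esub> P) \<star>\<^bsub>length Js\<^esub> (P \<star>\<^bsub>length Js\<^esub> B) =
        P \<star>\<^bsub>length Js\<^esub> B"
      by (simp add: P_def assoc cancel_A h1)
    show "B' \<star>\<^bsub>length Js\<^esub> P \<star>\<^bsub>length Js\<^esub> (P \<star>\<^bsub>length Js\<^esub> B) \<star>\<^bsub>length Ks\<^esub> (B' \<star>\<^bsub>length Js\<^esub> P) =
        B' \<star>\<^bsub>length Js\<^esub> P"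
    proof -
      have "B' \<star>\<^bsub>length Js\<^esub> P \<star>\<^bsub>length Js\<^esub> (P \<star>\<^bsub>length Js\<^esub> B) \<star>\<^bsub>length Ks\<^esub> (B' \<star>\<^bsub>length Js\<^esub> P) =
          B' \<star>\<^bsub>length Js\<^esub> (P \<star>\<^bsub>length Js\<^esub> P) \<star>\<^bsub>length Js\<^esub> B \<star>\<^bsub>length Ks\<^esub> (B' \<star>\<^bsub>length Js\<^esub> P)"
        by (simp add: assoc P)
      then show ?thesis unfolding PP by (simp add: P_def assoc h2)
    qed
  qed (use h3 h4 in \<open>simp_all add: order_def P dims\<close>)
  then show ?thesis by (simp add: P_def assoc)
qed

theorem theorem3p7:
  fixes A B :: tensor and Is Js Ks :: "nat list" and M N L :: nat
  assumes "length Is = M" and "length Js = N" and "length Ks = L"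
    and "A \<in> tensors (Is @ Js)" and "B \<in> tensors (Js @ Ks)"
  shows "mp_inverse M (A \<star>\<^bsub>N\<^esub> B) = mp_inverse N B \<star>\<^bsub>N\<^esub> mp_inverse M A \<longleftrightarrow>
    mp_inverse N (mp_inverse M A \<star>\<^bsub>M\<^esub> A \<star>\<^bsub>N\<^esub> B) = mp_inverse N B \<star>\<^bsub>N\<^esub> mp_inverse M A \<star>\<^bsub>M\<^esub> A \<and>
    mp_inverse M (A \<star>\<^bsub>N\<^esub> B) = mp_inverse N (mp_inverse M A \<star>\<^bsub>M\<^esub> A \<star>\<^bsub>N\<^esub> B) \<star>\<^bsub>N\<^esub> mp_inverse M A"
proof -
  define A' B' where "A' = mp_inverse M A" and "B' = mp_inverse N B"
  have M: "M = length Is" and N: "N = length Js" using assms by auto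
  have A: "dims A = Is @ Js" and B: "dims B = Js @ Ks"
    using assms(4,5) by (simp_all add: tensors_def)
  have mpA: "is_mp_inverse (length Is) A A'" and mpB: "is_mp_inverse (length Js) B B'"
    using is_mp_inverse_mp_inverse[OF A] is_mp_inverse_mp_inverse[OF B]
    by (simp_all add: A'_def B'_def M N)
  note pA = mpA[unfolded is_mp_inverse_block[OF A]] and pB = mpB[unfolded is_mp_inverse_block[OF B]]
  have dims: "dims A = Is @ Js" "dims A' = Js @ Is" "dims B = Js @ Ks" "dims B' = Ks @ Js"
    using A B pA pB by auto
  have AB: "dims (A \<star>\<^bsub>N\<^esub> B) = Is @ Ks" and A'AB: "dims (A' \<star>\<^bsub>M\<^esub> A \<star>\<^bsub>N\<^esub> B) = Js @ Ks"
    by (simp_all add: order_def dims M N)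
  \<comment> \<open>Under (i) the right-hand side of (ii) is \<open>B' A' A A'\<close>, that is,
    \<open>B' A'\<close>. This yields (ii) in the forward direction and the claim in the
    converse.\<close>
  have A'AA': "B' \<star>\<^bsub>N\<^esub> A' \<star>\<^bsub>M\<^esub> A \<star>\<^bsub>N\<^esub> A' = B' \<star>\<^bsub>N\<^esub> A'"
    using pA by (simp add: einstein_prod_assoc order_def dims M N)
  have "mp_inverse N (A' \<star>\<^bsub>M\<^esub> A \<star>\<^bsub>N\<^esub> B) = B' \<star>\<^bsub>N\<^esub> A' \<star>\<^bsub>M\<^esub> A"
    if "mp_inverse M (A \<star>\<^bsub>N\<^esub> B) = B' \<star>\<^bsub>N\<^esub> A'"
  proof -
    have "is_mp_inverse (length Is) (A \<star>\<^bsub>length Js\<^esub> B) (B' \<star>\<^bsub>length Js\<^esub> A')"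
      using is_mp_inverse_mp_inverse[OF AB] that by (simp add: M N)
    then show ?thesis
      using mp_inverse_eqI[OF A'AB] mp_inverse_restrict_row_space[OF A B mpA mpB] by (simp add: M N)
  qed
  then have "mp_inverse M (A \<star>\<^bsub>N\<^esub> B) = B' \<star>\<^bsub>N\<^esub> A' \<longleftrightarrow>
      mp_inverse N (A' \<star>\<^bsub>M\<^esub> A \<star>\<^bsub>N\<^esub> B) = B' \<star>\<^bsub>N\<^esub> A' \<star>\<^bsub>M\<^esub> A \<and>
      mp_inverse M (A \<star>\<^bsub>N\<^esub> B) = mp_inverse N (A' \<star>\<^bsub>M\<^esub> A \<star>\<^bsub>N\<^esub> B) \<star>\<^bsub>N\<^esub> A'"
    using A'AA' by auto
  then show ?thesis unfolding A'_def B'_def .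
qed

end
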